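(* Let $G$ be a graph, let $D$ be a solvable distribution on $G$, and let $s=|\sigma(D)|$. Define $D_0=D$ and, for $i\ge0$, let $D_{i+1}$ be the distribution on $G\Box K_2^{i+1}$ (vertices written $(u,b)$ with $u\in V(G\Box K_2^{i})$ and $b\in\{0,1\}$ the new coordinate) given by $D_{i+1}((u,0))=E_{D_i(u)}(x_0)$ and $D_{i+1}((u,1))=E_{D_i(u)}(x_1)$. Then for every $m\ge0$, $D_m$ is a solvable distribution on $G\Box K_2^m\cong G\Box Q^m$ with $|\sigma(D_m)|\le 2^m s$ and \[|D_m|\le \left(\tfrac43\right)^m|D|+2^m s-\left(\tfrac43\right)^m s.\]
   Context: A distribution on a graph $G=(V,E)$ is a function $D:V\to\mathbb{N}$, with size $|D|=\sum_v D(v)$; its support is $\sigma(D)=\{v: D(v)>0\}$. A pebbling move removes two pebbles from a vertex having at least two pebbles and places one pebble on a neighbor. A distribution is solvable if for every vertex $v$, some sequence of pebbling moves starting from it results in a distribution with at least one pebble on $v$. $\Box$ is the Cartesian product of graphs, $K_2^m$ the $m$-fold product of $K_2$ (the hypercube $Q^m$). With $K_2$ having vertices $x_0,x_1$, for integers $k\ge0$ the distributions $E_r$ on $K_2$ are: $E_{3k}(x_0)=E_{3k}(x_1)=2k$; $E_{3k+1}(x_0)=2k+2$, $E_{3k+1}(x_1)=2k$; $E_{3k+2}(x_0)=2k+2$, $E_{3k+2}(x_1)=2k+1$. *)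

theory Defs
  imports Complex_Main "Graph_Theory.Pair_Digraph"
begin

text \<open>Graphs are finite simple graphs, i.e. \<open>pair_graph\<close>: every edge is stored as the two
  ordered pairs of its endpoints. A distribution is a total function on the vertex type of
  which only the values on the vertex set are ever used.\<close>

definition dist_size :: "'a pair_pre_digraph \<Rightarrow> ('a \<Rightarrow> nat) \<Rightarrow> nat" where
  "dist_size G D = (\<Sum>v\<in>pverts G. D v)"

definition dist_support :: "'a pair_pre_digraph \<Rightarrow> ('a \<Rightarrow> nat) \<Rightarrow> 'a set" where
  "dist_support G D = {v \<in> pverts G. D v > 0}"

definition pebbling_move :: "'a pair_pre_digraph \<Rightarrow> ('a \<Rightarrow> nat) \<Rightarrow> ('a \<Rightarrow> nat) \<Rightarrow> bool" where
  "pebbling_move G D D' \<longleftrightarrow>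
     (\<exists>u v. (u, v) \<in> parcs G \<and> D u \<ge> 2 \<and> D' = D(u := D u - 2, v := D v + 1))"

definition solvable :: "'a pair_pre_digraph \<Rightarrow> ('a \<Rightarrow> nat) \<Rightarrow> bool" where
  "solvable G D \<longleftrightarrow> (\<forall>v\<in>pverts G. \<exists>D'. (pebbling_move G)\<^sup>*\<^sup>* D D' \<and> D' v \<ge> 1)"

definition cart_prod ::
    "'a pair_pre_digraph \<Rightarrow> 'b pair_pre_digraph \<Rightarrow> ('a \<times> 'b) pair_pre_digraph" where
  "cart_prod G H = \<lparr> pverts = pverts G \<times> pverts H,
     parcs = {((u, x), (v, y)). (u = v \<and> u \<in> pverts G \<and> (x, y) \<in> parcs H)
                              \<or> ((u, v) \<in> parcs G \<and> x = y \<and> x \<in> pverts H)} \<rparr>"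

definition relabel :: "('a \<Rightarrow> 'b) \<Rightarrow> 'a pair_pre_digraph \<Rightarrow> 'b pair_pre_digraph" where
  "relabel f G = \<lparr> pverts = f ` pverts G, parcs = map_prod f f ` parcs G \<rparr>"

text \<open>The \<open>m\<close>-fold product of \<open>H\<close>. The nested pairs \<open>((x\<^sub>1, x\<^sub>2), \<dots>, x\<^sub>m)\<close> are flattened to the
  list \<open>[x\<^sub>1, \<dots>, x\<^sub>m]\<close>, so that all powers live on one type; the newest coordinate is the last
  entry.\<close>

primrec cart_power :: "'a pair_pre_digraph \<Rightarrow> nat \<Rightarrow> 'a list pair_pre_digraph" where
  "cart_power H 0 = \<lparr> pverts = {[]}, parcs = {} \<rparr>"
| "cart_power H (Suc m) = relabel (\<lambda>(xs, x). xs @ [x]) (cart_prod (cart_power H m) H)"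

text \<open>The vertices of \<open>K\<^sub>2\<close> are \<open>x\<^sub>0 = False\<close> and \<open>x\<^sub>1 = True\<close>.\<close>

definition K2 :: "bool pair_pre_digraph" where
  "K2 = \<lparr> pverts = {False, True}, parcs = {(False, True), (True, False)} \<rparr>"

definition E :: "nat \<Rightarrow> bool \<Rightarrow> nat" where
  "E r x = (let k = r div 3 in
     if r mod 3 = 0 then 2 * k
     else if r mod 3 = 1 then (if x then 2 * k else 2 * k + 2)
     else (if x then 2 * k + 1 else 2 * k + 2))"

lemma E_simps:
  "E (3 * k) False = 2 * k"  "E (3 * k) True = 2 * k"
  "E (3 * k + 1) False = 2 * k + 2"  "E (3 * k + 1) True = 2 * k"
  "E (3 * k + 2) False = 2 * k + 2"  "E (3 * k + 2) True = 2 * k + 1"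
proof -
  have "(3 * k + 1) mod 3 = 1" "(3 * k + 1) div 3 = k"
       "(3 * k + 2) mod 3 = 2" "(3 * k + 2) div 3 = k"
    by presburger+
  then show
    "E (3 * k) False = 2 * k"  "E (3 * k) True = 2 * k"
    "E (3 * k + 1) False = 2 * k + 2"  "E (3 * k + 1) True = 2 * k"
    "E (3 * k + 2) False = 2 * k + 2"  "E (3 * k + 2) True = 2 * k + 1"
    unfolding E_def Let_def by simp_all
qed

text \<open>\<open>dist_seq D i\<close> is the distribution \<open>D\<^sub>i\<close> on \<open>cart_prod G (cart_power K2 i)\<close>. The vertex
  \<open>((u, bs), b)\<close> of \<open>(G \<box> K\<^sub>2\<^sup>i) \<box> K\<^sub>2\<close> is the vertex \<open>(u, bs @ [b])\<close> of \<open>G \<box> K\<^sub>2\<^sup>i\<^sup>+\<^sup>1\<close>.\<close>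

primrec dist_seq :: "('a \<Rightarrow> nat) \<Rightarrow> nat \<Rightarrow> 'a \<times> bool list \<Rightarrow> nat" where
  "dist_seq D 0 = (\<lambda>(u, bs). D u)"
| "dist_seq D (Suc i) = (\<lambda>(u, bs). E (dist_seq D i (u, butlast bs)) (last bs))"

lemma dist_seq_Suc_snoc: "dist_seq D (Suc i) (u, bs @ [b]) = E (dist_seq D i (u, bs)) b"
  by simp

text \<open>The identifications used by \<open>dist_seq\<close> are graph isomorphisms.\<close>

lemma cart_prod_power_0:
  "cart_prod G (cart_power H 0) = relabel (\<lambda>u. (u, [])) G"
  "inj (\<lambda>u. (u, []))"
  by (auto simp: cart_prod_def relabel_def inj_def image_iff)

lemma cart_prod_power_Suc:
  "cart_prod G (cart_power H (Suc i)) =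
     relabel (\<lambda>((u, xs), x). (u, xs @ [x])) (cart_prod (cart_prod G (cart_power H i)) H)"
  "inj (\<lambda>((u, xs), x). (u, xs @ [x]))"
proof -
  show "inj (\<lambda>((u, xs), x). (u, xs @ [x]))"
    by (auto simp: inj_def)
  show "cart_prod G (cart_power H (Suc i)) =
     relabel (\<lambda>((u, xs), x). (u, xs @ [x])) (cart_prod (cart_prod G (cart_power H i)) H)"
    by (auto simp: cart_prod_def relabel_def image_iff map_prod_def split: prod.splits)
qed

text \<open>\<open>cart_power K2 m\<close> is the usual hypercube on bit strings of length \<open>m\<close>.\<close>

lemma pverts_cart_power_K2: "pverts (cart_power K2 m) = {bs. length bs = m}"
proof (induction m)
  case (Suc m)
  have "bs \<in> (\<lambda>(xs, x). xs @ [x]) ` ({bs. length bs = m} \<times> UNIV)" if "length bs = Suc m"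
    for bs :: "bool list"
    using that by (cases bs rule: rev_cases) auto
  then show ?case
    using Suc by (auto simp: relabel_def cart_prod_def K2_def UNIV_bool)
qed simp

lemma parcs_cart_power_K2:
  "(as, bs) \<in> parcs (cart_power K2 m) \<longleftrightarrow>
     length as = m \<and> length bs = m \<and> card {i. i < m \<and> as ! i \<noteq> bs ! i} = 1"
proof (induction m arbitrary: as bs)
  case 0
  then show ?case by simp
next
  case (Suc m)
  show ?case
  proof (cases "length as = Suc m \<and> length bs = Suc m")
    case False
    have "length as = Suc m \<and> length bs = Suc m" if "(as, bs) \<in> parcs (cart_power K2 (Suc m))"
      using that Suc.IH pverts_cart_power_K2[of m]
      by (auto simp: relabel_def cart_prod_def)
    with False show ?thesis by blast
  next
    case True
    then obtain as' a bs' b where ab: "as = as' @ [a]" "bs = bs' @ [b]"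
      "length as' = m" "length bs' = m"
      by (cases as rule: rev_cases; cases bs rule: rev_cases) auto
    have "{i. i < Suc m \<and> as ! i \<noteq> bs ! i} =
        {i. i < m \<and> as' ! i \<noteq> bs' ! i} \<union> (if a = b then {} else {m})"
      using ab by (auto simp: nth_append less_Suc_eq)
    then have card: "card {i. i < Suc m \<and> as ! i \<noteq> bs ! i} =
        card {i. i < m \<and> as' ! i \<noteq> bs' ! i} + (if a = b then 0 else 1)"
      by simp
    have zero: "card {i. i < m \<and> as' ! i \<noteq> bs' ! i} = 0 \<longleftrightarrow> as' = bs'"
      using ab by (auto simp: list_eq_iff_nth_eq)
    have "(as, bs) \<in> parcs (cart_power K2 (Suc m)) \<longleftrightarrow>
        ((as', a), (bs', b)) \<in> parcs (cart_prod (cart_power K2 m) K2)"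
      using ab by (force simp: relabel_def)
    also have "\<dots> \<longleftrightarrow> as' = bs' \<and> a \<noteq> b \<or> (as', bs') \<in> parcs (cart_power K2 m) \<and> a = b"
      using ab pverts_cart_power_K2[of m] by (auto simp: cart_prod_def K2_def)
    finally show ?thesis
      using Suc.IH[of as' bs'] ab card zero by auto
  qed
qed

end

(* For a target in layer x of the product with K2, collapse every pile onto that layer: the piles
   E r x and E r (\<not> x) turn into E r x + E r (\<not> x) div 2 \<ge> r pebbles. Layer x
   then dominates the original solvable distribution, so the solution in G can be replayed there.
   The size bound iterates 3 (E r x0 + E r x1) \<le> 4 r + 2 for r > 0, together with the doubling
   of the support. *)
theory Submission
  imports Defs
begin

text \<open>Extra pebbles never block a move, so a move along \<open>(u, v)\<close> can be copied
  along \<open>(f u, f v)\<close>. Injectivity of \<open>f\<close> keeps the copied update away from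
  all other images, hence domination persists. Used both for embedding \<open>G\<close> as a layer
  and for relabelling.\<close>

lemma pebbling_transfer:
  assumes inj: "inj f"
    and hom: "\<And>u v. (u, v) \<in> parcs G \<Longrightarrow> (f u, f v) \<in> parcs H"
    and wf: "parcs G \<subseteq> V \<times> V"
    and reach: "(pebbling_move G)\<^sup>*\<^sup>* D D1"
    and dom: "\<forall>u\<in>V. D u \<le> D' (f u)"
  shows "\<exists>D1'. (pebbling_move H)\<^sup>*\<^sup>* D' D1' \<and> (\<forall>u\<in>V. D1 u \<le> D1' (f u))"
  using reach
proof (induction rule: rtranclp_induct)
  case base
  then show ?case using dom by blast
next
  case (step D1 D2)
  then obtain D1' where D1': "(pebbling_move H)\<^sup>*\<^sup>* D' D1'" "\<forall>u\<in>V. D1 u \<le> D1' (f u)"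
    by blast
  from step.hyps(2) obtain u v where
    uv: "(u, v) \<in> parcs G" "D1 u \<ge> 2" "D2 = D1(u := D1 u - 2, v := D1 v + 1)"
    unfolding pebbling_move_def by blast
  let ?D2' = "D1'(f u := D1' (f u) - 2, f v := D1' (f v) + 1)"
  have "u \<in> V" "v \<in> V"
    using uv(1) wf by auto
  then have "pebbling_move H D1' ?D2'"
    using uv(2) D1'(2) hom[OF uv(1)] unfolding pebbling_move_def by (blast intro: order_trans)
  moreover have "\<forall>w\<in>V. D2 w \<le> ?D2' (f w)"
    using D1'(2) \<open>u \<in> V\<close> \<open>v \<in> V\<close> inj
    by (auto simp: uv(3) inj_eq intro: diff_le_mono)
  ultimately show ?case
    using D1'(1) by (meson rtranclp.rtrancl_into_rtrancl)
qed

lemma pebbling_move_iterate: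
  assumes "(u, v) \<in> parcs G" "u \<noteq> v" "2 * k \<le> D u"
  shows "(pebbling_move G)\<^sup>*\<^sup>* D (D(u := D u - 2 * k, v := D v + k))"
  using assms(3)
proof (induction k)
  case (Suc k)
  let ?F = "\<lambda>k. D(u := D u - 2 * k, v := D v + k)"
  \<comment> \<open>Since \<open>u \<noteq> v\<close>, neither update overwrites the other and one
    more move only extends the closed form.\<close>
  have "?F (Suc k) = (?F k)(u := ?F k u - 2, v := ?F k v + 1)"
    using \<open>u \<noteq> v\<close> by auto
  moreover have "?F k u \<ge> 2"
    using Suc.prems \<open>u \<noteq> v\<close> by simp
  ultimately have "pebbling_move G (?F k) (?F (Suc k))"
    using assms(1) unfolding pebbling_move_def by blast
  with Suc show ?case
    by (meson Suc_leD add_leD2 mult_Suc_right order_trans rtranclp.rtrancl_into_rtrancl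
        mult_le_mono2 le_SucI le_refl)
qed simp

lemma mod3_cases:
  fixes r :: nat
  obtains k where "r = 3 * k" | k where "r = 3 * k + 1" | k where "r = 3 * k + 2"
proof -
  have "r = 3 * (r div 3) \<or> r = 3 * (r div 3) + 1 \<or> r = 3 * (r div 3) + 2"
    by presburger
  then show thesis using that by blast
qed

text \<open>The sum is exactly \<open>r\<close>, except that it is \<open>r + 1\<close> when
  \<open>r = 3 * k + 1\<close> and \<open>x = False\<close>. So the rounding in \<open>E\<close>
  lets either layer recover \<open>r\<close> pebbles.\<close>

lemma le_E_collapse: "r \<le> E r x + E r (\<not> x) div 2"
  \<comment> \<open>Deleting these simp rules keeps \<open>3 * k + 1\<close> and
    \<open>3 * k + 2\<close> in the form that \<open>E_simps\<close> matches.\<close>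
  by (cases r rule: mod3_cases; cases x) (auto simp: E_simps simp del: One_nat_def add_2_eq_Suc')

text \<open>For residues 0, 1, 2 the two piles total \<open>4 * k\<close>, \<open>4 * k + 2\<close>,
  \<open>4 * k + 3\<close>, so three times the total exceeds \<open>4 * r\<close> by 0, 2, 1. The
  indicator drops the correction at empty vertices, so that summing it counts the support.\<close>

lemma E_sum_le: "3 * (E r False + E r True) \<le> 4 * r + 2 * of_bool (0 < r)"
  by (cases r rule: mod3_cases) (auto simp: E_simps simp del: One_nat_def add_2_eq_Suc')

lemma E_0: "E 0 x = 0"
  by (simp add: E_def)

text \<open>Fibres are collapsed one vertex of \<open>S\<close> at a time. The last conjunct
  strengthens the induction: fibres outside \<open>S\<close> still hold their initial piles, so the
  pile sizes at the next vertex are known.\<close>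

lemma pebbling_collapse_layer:
  assumes "finite S" "S \<subseteq> pverts G"
  shows "\<exists>F. (pebbling_move (cart_prod G K2))\<^sup>*\<^sup>* (\<lambda>(u, b). E (D u) b) F
    \<and> (\<forall>u\<in>S. D u \<le> F (u, x)) \<and> (\<forall>u b. u \<notin> S \<longrightarrow> F (u, b) = E (D u) b)"
  using assms
proof (induction rule: finite_induct)
  case empty
  then show ?case by auto
next
  case (insert w S)
  then obtain F where F: "(pebbling_move (cart_prod G K2))\<^sup>*\<^sup>* (\<lambda>(u, b). E (D u) b) F"
    "\<forall>u\<in>S. D u \<le> F (u, x)" "\<And>u b. u \<notin> S \<Longrightarrow> F (u, b) = E (D u) b"
    by auto
  \<comment> \<open>The largest number of moves that the pile at \<open>(w, \<not> x)\<close>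
    permits towards \<open>(w, x)\<close>.\<close>
  let ?k = "E (D w) (\<not> x) div 2"
  let ?F' = "F((w, \<not> x) := F (w, \<not> x) - 2 * ?k, (w, x) := F (w, x) + ?k)"
  have "((w, \<not> x), (w, x)) \<in> parcs (cart_prod G K2)"
    using insert.prems by (auto simp: cart_prod_def K2_def)
  then have "(pebbling_move (cart_prod G K2))\<^sup>*\<^sup>* F ?F'"
    using F(3)[OF insert.hyps(2)] by (intro pebbling_move_iterate) auto
  moreover have "\<forall>u\<in>insert w S. D u \<le> ?F' (u, x)"
    using F(2) F(3)[OF insert.hyps(2)] le_E_collapse[of "D w" x] insert.hyps(2) by auto
  moreover have "\<forall>u b. u \<notin> insert w S \<longrightarrow> ?F' (u, b) = E (D u) b"
    using F(3) by auto
  ultimately show ?case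
    using F(1) by (meson rtranclp_trans)
qed

lemma solvable_cart_prod_K2:
  assumes "pair_fin_digraph G" "solvable G D"
  shows "solvable (cart_prod G K2) (\<lambda>(u, b). E (D u) b)"
  unfolding solvable_def
proof
  interpret pair_fin_digraph G by fact
  fix y assume "y \<in> pverts (cart_prod G K2)"
  then obtain v x where y: "y = (v, x)" "v \<in> pverts G"
    by (auto simp: cart_prod_def)
  obtain F where F: "(pebbling_move (cart_prod G K2))\<^sup>*\<^sup>* (\<lambda>(u, b). E (D u) b) F"
    "\<forall>u\<in>pverts G. D u \<le> F (u, x)"
    using pebbling_collapse_layer[OF finite_verts order_refl] by blast
  obtain D1 where D1: "(pebbling_move G)\<^sup>*\<^sup>* D D1" "D1 v \<ge> 1"
    using assms(2) y(2) unfolding solvable_def by blast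
  \<comment> \<open>Layer \<open>x\<close> is a copy of \<open>G\<close> via
    \<open>u \<mapsto> (u, x)\<close>, and after the collapse it dominates \<open>D\<close>.\<close>
  have "\<exists>F1. (pebbling_move (cart_prod G K2))\<^sup>*\<^sup>* F F1 \<and> (\<forall>u\<in>pverts G. D1 u \<le> F1 (u, x))"
    using D1(1) F(2)
    by (intro pebbling_transfer[where f = "\<lambda>u. (u, x)"])
      (auto simp: inj_def cart_prod_def K2_def dest: in_arcsD1 in_arcsD2)
  then obtain F1 where "(pebbling_move (cart_prod G K2))\<^sup>*\<^sup>* F F1" "D1 v \<le> F1 (v, x)"
    using y(2) by blast
  with F(1) D1(2) y(1) show
    "\<exists>D'. (pebbling_move (cart_prod G K2))\<^sup>*\<^sup>* (\<lambda>(u, b). E (D u) b) D' \<and> 1 \<le> D' y"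
    by (meson order_trans rtranclp_trans)
qed

lemma dist_size_cart_prod_K2:
  assumes "finite (pverts G)"
  shows "3 * dist_size (cart_prod G K2) (\<lambda>(u, b). E (D u) b)
    \<le> 4 * dist_size G D + 2 * card (dist_support G D)"
proof -
  have "dist_size (cart_prod G K2) (\<lambda>(u, b). E (D u) b)
      = (\<Sum>u\<in>pverts G. E (D u) False + E (D u) True)"
    by (simp add: dist_size_def cart_prod_def K2_def flip: sum.cartesian_product)
  then have "3 * dist_size (cart_prod G K2) (\<lambda>(u, b). E (D u) b)
      \<le> (\<Sum>u\<in>pverts G. 4 * D u + 2 * of_bool (0 < D u))"
    by (simp only: sum_distrib_left sum_mono E_sum_le)
  also have "\<dots> = 4 * dist_size G D + 2 * card (dist_support G D)"
    using assms by (simp add: dist_size_def dist_support_def sum.distrib Int_def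
        flip: sum_distrib_left)
  finally show ?thesis .
qed

lemma card_dist_support_cart_prod_K2:
  assumes "finite (pverts G)"
  shows "card (dist_support (cart_prod G K2) (\<lambda>(u, b). E (D u) b))
    \<le> 2 * card (dist_support G D)"
proof -
  \<comment> \<open>By \<open>E_0\<close>, the fibre over an empty vertex stays empty.\<close>
  have "dist_support (cart_prod G K2) (\<lambda>(u, b). E (D u) b)
      \<subseteq> dist_support G D \<times> (UNIV :: bool set)"
    by (auto simp: dist_support_def cart_prod_def E_0 intro: gr0I)
  moreover have "finite (dist_support G D)"
    using assms by (simp add: dist_support_def)
  ultimately have "card (dist_support (cart_prod G K2) (\<lambda>(u, b). E (D u) b))
      \<le> card (dist_support G D \<times> (UNIV :: bool set))"
    by (intro card_mono) auto
  then show ?thesis by (simp add: card_cartesian_product mult.commute)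
qed

text \<open>Arcs map to arcs by construction, so a solution for the pulled-back distribution is
  replayed through \<open>f\<close>; domination starts out as equality.\<close>

lemma solvable_relabel:
  assumes "inj f" "solvable G (D \<circ> f)"
  shows "solvable (relabel f G) D"
  unfolding solvable_def
proof
  fix y assume "y \<in> pverts (relabel f G)"
  then obtain v where v: "y = f v" "v \<in> pverts G"
    by (auto simp: relabel_def)
  then obtain D1 where D1: "(pebbling_move G)\<^sup>*\<^sup>* (D \<circ> f) D1" "D1 v \<ge> 1"
    using assms(2) unfolding solvable_def by blast
  have "\<exists>D1'. (pebbling_move (relabel f G))\<^sup>*\<^sup>* D D1' \<and> (\<forall>u\<in>UNIV. D1 u \<le> D1' (f u))"
    using assms(1) D1(1) by (intro pebbling_transfer) (auto simp: relabel_def)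
  with D1(2) v(1) show "\<exists>D'. (pebbling_move (relabel f G))\<^sup>*\<^sup>* D D' \<and> 1 \<le> D' y"
    by (meson UNIV_I order_trans)
qed

lemma dist_size_relabel:
  assumes "inj f"
  shows "dist_size (relabel f G) D = dist_size G (D \<circ> f)"
  using assms by (simp add: dist_size_def relabel_def sum.reindex inj_on_subset)

lemma card_dist_support_relabel:
  assumes "inj f"
  shows "card (dist_support (relabel f G) D) = card (dist_support G (D \<circ> f))"
proof -
  have "dist_support (relabel f G) D = f ` dist_support G (D \<circ> f)"
    by (auto simp: dist_support_def relabel_def)
  then show ?thesis
    using assms by (simp add: card_image inj_on_subset)
qed

lemma pair_fin_digraphI:
  assumes "finite (pverts G)" "parcs G \<subseteq> pverts G \<times> pverts G"
  shows "pair_fin_digraph G"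
proof
  show "finite (parcs G)"
    using assms by (meson finite_SigmaI finite_subset)
qed (use assms in auto)

lemma pair_fin_digraph_relabel:
  assumes "pair_fin_digraph G"
  shows "pair_fin_digraph (relabel f G)"
proof -
  interpret pair_fin_digraph G by fact
  show ?thesis
    by (rule pair_fin_digraphI) (auto simp: relabel_def dest: in_arcsD1 in_arcsD2)
qed

lemma pair_fin_digraph_cart_prod_K2:
  assumes "pair_fin_digraph G"
  shows "pair_fin_digraph (cart_prod G K2)"
proof -
  interpret pair_fin_digraph G by fact
  show ?thesis
    by (rule pair_fin_digraphI) (auto simp: cart_prod_def K2_def dest: in_arcsD1 in_arcsD2)
qed

text \<open>Provides, at every stage, the finite vertex set for collapsing and summing, and the arcs
  between vertices for replaying moves.\<close>

lemma pair_fin_digraph_cart_prod_power_K2: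
  assumes "pair_fin_digraph G"
  shows "pair_fin_digraph (cart_prod G (cart_power K2 m))"
proof (induction m)
  case 0
  then show ?case
    using assms by (simp only: cart_prod_power_0 pair_fin_digraph_relabel)
next
  case (Suc m)
  then show ?case
    by (simp only: cart_prod_power_Suc pair_fin_digraph_relabel pair_fin_digraph_cart_prod_K2)
qed

text \<open>Pulling back along the flattening map undoes \<open>butlast\<close> and
  \<open>last\<close>, leaving the one-step distribution treated by the \<open>K2\<close>
  lemmas.\<close>

lemma dist_seq_Suc_comp:
  "dist_seq D (Suc m) \<circ> (\<lambda>((u, xs), x). (u, xs @ [x])) = (\<lambda>(p, b). E (dist_seq D m p) b)"
  by (auto simp: fun_eq_iff)

theorem theorem6p5:
  fixes G :: "'a pair_pre_digraph" and D :: "'a \<Rightarrow> nat" and s :: nat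
  assumes "pair_graph G"
    and "solvable G D"
    and "s = card (dist_support G D)"
  shows "\<forall>m :: nat.
    solvable (cart_prod G (cart_power K2 m)) (dist_seq D m) \<and>
    card (dist_support (cart_prod G (cart_power K2 m)) (dist_seq D m)) \<le> 2 ^ m * s \<and>
    real (dist_size (cart_prod G (cart_power K2 m)) (dist_seq D m))
      \<le> (4 / 3) ^ m * real (dist_size G D) + 2 ^ m * real s - (4 / 3) ^ m * real s"
proof
  interpret pair_graph G by fact
  fix m :: nat
  show "solvable (cart_prod G (cart_power K2 m)) (dist_seq D m) \<and>
    card (dist_support (cart_prod G (cart_power K2 m)) (dist_seq D m)) \<le> 2 ^ m * s \<and>
    real (dist_size (cart_prod G (cart_power K2 m)) (dist_seq D m))
      \<le> (4 / 3) ^ m * real (dist_size G D) + 2 ^ m * real s - (4 / 3) ^ m * real s"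
  proof (induction m)
    case 0
    have "dist_seq D 0 \<circ> (\<lambda>u. (u, [])) = D"
      by auto
    \<comment> \<open>Here the size bound is an equality, since the two terms in \<open>s\<close>
      cancel.\<close>
    then show ?case
      using assms(2,3)
      by (simp only: cart_prod_power_0 solvable_relabel dist_size_relabel
          card_dist_support_relabel) simp
  next
    case (Suc m)
    let ?H = "cart_prod G (cart_power K2 m)"
    let ?D = "dist_seq D m"
    let ?D' = "\<lambda>(p, b). E (?D p) b"
    have fin: "pair_fin_digraph ?H"
      by (rule pair_fin_digraph_cart_prod_power_K2) unfold_locales
    then have finV: "finite (pverts ?H)"
      by (rule pair_fin_digraph.pair_finite_verts)
    have supp: "card (dist_support (cart_prod ?H K2) ?D') \<le> 2 ^ Suc m * s"
      using card_dist_support_cart_prod_K2[OF finV, of ?D] Suc by simp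
    have "3 * real (dist_size (cart_prod ?H K2) ?D')
        \<le> 4 * real (dist_size ?H ?D) + 2 * real (card (dist_support ?H ?D))"
      using dist_size_cart_prod_K2[OF finV, of ?D] by linarith
    moreover have "real (card (dist_support ?H ?D)) \<le> 2 ^ m * real s"
      using Suc by (metis of_nat_le_iff of_nat_mult of_nat_numeral of_nat_power)
    \<comment> \<open>The excess of the size over \<open>2 ^ m * s\<close> grows at most by the
      factor 4/3, because \<open>4 / 3 + 2 / 3 = 2\<close>. Unfolding the powers leaves a linear
      inequality in the products with the \<open>m\<close>-th powers.\<close>
    ultimately have "real (dist_size (cart_prod ?H K2) ?D')
      \<le> (4 / 3) ^ Suc m * real (dist_size G D) + 2 ^ Suc m * real s - (4 / 3) ^ Suc m * real s"
      using Suc unfolding power_Suc mult.assoc by linarith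
    \<comment> \<open>All three bounds on the nested product pass to the flattened one by
      injectivity of the flattening map.\<close>
    with supp solvable_cart_prod_K2[OF fin] Suc show ?case
      by (simp only: cart_prod_power_Suc solvable_relabel dist_size_relabel
          card_dist_support_relabel dist_seq_Suc_comp)
  qed
qed

end
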